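(* Let $a<b$ be real numbers, let $c_i \in (a,b)$ and $w_i > 0$ for $i=1,\ldots,n$ with $\sum_{i=1}^n w_i = 1$, and let $p, q > 0$ with $p + q = 1$, such that $\sum_{i=1}^n w_i c_i = pa + qb$. Then the system of equations and conditions $$\sum_{i=1}^n p_i = p,\quad p_i > 0,\quad \sum_{i=1}^n q_i = q,\quad q_i > 0,\quad p_i + q_i = w_i,\quad \frac{p_i a + q_i b}{p_i + q_i} = c_i, \quad i = 1,\ldots,n,$$ in the unknowns $p_1,\ldots,p_n,q_1,\ldots,q_n$ has a unique solution, namely $$p_i = w_i \theta_i, \quad q_i = w_i (1-\theta_i), \quad i = 1,\ldots,n,$$ where $\theta_i$ is defined by $\theta_i a + (1-\theta_i) b = c_i$. *)

theory Defs
  imports Complex_Main "HOL-Library.FuncSet"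
begin

definition splitting_system ::
  "real \<Rightarrow> real \<Rightarrow> nat \<Rightarrow> (nat \<Rightarrow> real) \<Rightarrow> (nat \<Rightarrow> real) \<Rightarrow> real \<Rightarrow> real
    \<Rightarrow> (nat \<Rightarrow> real) \<Rightarrow> (nat \<Rightarrow> real) \<Rightarrow> bool"
where
  "splitting_system a b n c w p q ps qs \<longleftrightarrow>
     (\<Sum>i=1..n. ps i) = p \<and> (\<forall>i\<in>{1..n}. ps i > 0) \<and>
     (\<Sum>i=1..n. qs i) = q \<and> (\<forall>i\<in>{1..n}. qs i > 0) \<and>
     (\<forall>i\<in>{1..n}. ps i + qs i = w i) \<and>
     (\<forall>i\<in>{1..n}. (ps i * a + qs i * b) / (ps i + qs i) = c i)"

(* Meaningful only when the equation determines t uniquely, i.e. when a and b differ. *)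
definition theta :: "real \<Rightarrow> real \<Rightarrow> real \<Rightarrow> real" where
  "theta a b x = (THE t. t * a + (1 - t) * b = x)"

(* An n-tuple indexed by 1, ..., n is an extensional function on {1..n}, so that equality of
   such functions is equality of tuples. *)
abbreviation tuples :: "nat \<Rightarrow> (nat \<Rightarrow> real) set" where
  "tuples n \<equiv> {1..n} \<rightarrow>\<^sub>E UNIV"

end

theory Submission
  imports Defs
begin

text \<open>
  For a single index the conditions \<open>p\<^sub>i + q\<^sub>i = w\<^sub>i\<close> and
  \<open>(p\<^sub>i a + q\<^sub>i b) / (p\<^sub>i + q\<^sub>i) = c\<^sub>i\<close> form a linear system in the two unknowns
  \<open>p\<^sub>i\<close>, \<open>q\<^sub>i\<close>, and its determinant is nonzero because \<open>a \<noteq> b\<close>.  The indices are therefore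
  decoupled, and these two conditions alone already determine every \<open>p\<^sub>i\<close> and \<open>q\<^sub>i\<close>
  (lemma \<open>two_point_split_iff\<close>).  What is left is existence, that is, that the forced values
  also satisfy the remaining conditions.  Positivity says that \<open>c\<^sub>i\<close> lies strictly
  between \<open>a\<close> and \<open>b\<close>.  The two sum conditions say that \<open>p\<close> and \<open>q\<close> are the split of the total
  mass \<open>1\<close> whose mean is the overall mean \<open>\<Sum> w\<^sub>i c\<^sub>i = p a + q b\<close>: the barycentric coordinate
  is affine in the point, so averaging the \<open>\<theta>\<^sub>i\<close> gives the coordinate of the average, which
  is \<open>p\<close> (lemma \<open>sum_weighted_theta\<close>).
\<close>

lemma barycentric_iff:
  fixes a b t x :: real
  assumes "a < b"
  shows "t * a + (1 - t) * b = x \<longleftrightarrow> t = (b - x) / (b - a)"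
  using assms by (simp add: field_simps) argo

lemma barycentric_ex1:
  fixes a b x :: real
  assumes "a < b"
  shows "\<exists>!t. t * a + (1 - t) * b = x"
  using assms by (simp add: barycentric_iff)

lemma theta_eq:
  assumes "a < b"
  shows "theta a b x = (b - x) / (b - a)"
  using assms by (simp add: theta_def barycentric_iff)

lemma theta_bounds:
  assumes "a < b" and "x \<in> {a<..<b}"
  shows "0 < theta a b x" and "theta a b x < 1"
  using assms by (simp_all add: theta_eq)

text \<open>
  After division by the total mass \<open>u\<close>, the share \<open>r / u\<close> of the mass at \<open>a\<close> has to be the
  barycentric coordinate of the mean \<open>x\<close>, and the mass at \<open>b\<close> is the remainder.
\<close>

lemma two_point_split_iff:
  fixes a b u x r s :: real
  assumes "a < b" and "u > 0"
  shows "r + s = u \<and> (r * a + s * b) / (r + s) = x \<longleftrightarrow>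
    r = u * theta a b x \<and> s = u * (1 - theta a b x)"
proof -
  have "r + s = u \<and> (r * a + s * b) / (r + s) = x \<longleftrightarrow>
      s = u - r \<and> (r / u) * a + (1 - r / u) * b = x"
    using assms(2) by (auto simp: field_simps)
  also have "\<dots> \<longleftrightarrow> s = u - r \<and> r / u = theta a b x"
    unfolding barycentric_iff[OF assms(1)] theta_eq[OF assms(1)] by (rule refl)
  also have "\<dots> \<longleftrightarrow> r = u * theta a b x \<and> s = u * (1 - theta a b x)"
    using assms(2) by (auto simp: field_simps)
  finally show ?thesis .
qed

text \<open>
  The function \<open>theta a b\<close> is affine, so it commutes with averages; the point \<open>p a + q b\<close> has
  coordinate \<open>p\<close> because \<open>p + q = 1\<close>.
\<close>

lemma sum_weighted_theta:
  assumes "a < b" and "sum w I = 1" and "p + q = 1"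
    and "(\<Sum>i\<in>I. w i * c i) = p * a + q * b"
  shows "(\<Sum>i\<in>I. w i * theta a b (c i)) = p"
proof -
  have "(\<Sum>i\<in>I. w i * theta a b (c i)) = (\<Sum>i\<in>I. (w i * b - w i * c i) / (b - a))"
    using assms(1) by (simp add: theta_eq right_diff_distrib)
  also have "\<dots> = (b - (p * a + q * b)) / (b - a)"
    using assms(2,4)
    by (simp add: sum_divide_distrib[symmetric] sum_subtractf sum_distrib_right[symmetric])
  also have "\<dots> = theta a b (p * a + q * b)"
    using assms(1) by (simp add: theta_eq)
  also have "\<dots> = p"
  proof -
    have "q = 1 - p"
      using assms(3) by simp
    then show ?thesis
      using assms(1) barycentric_iff[of a b p "p * a + q * b"] by (simp add: theta_eq)
  qed
  finally show ?thesis .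
qed

theorem theorem2p6:
  fixes a b p q :: real and n :: nat and c w :: "nat \<Rightarrow> real"
  assumes "a < b"
    and "\<And>i. i \<in> {1..n} \<Longrightarrow> c i \<in> {a<..<b}"
    and "\<And>i. i \<in> {1..n} \<Longrightarrow> w i > 0"
    and "(\<Sum>i=1..n. w i) = 1"
    and "p > 0" and "q > 0" and "p + q = 1"
    and "(\<Sum>i=1..n. w i * c i) = p * a + q * b"
  shows "(\<forall>i\<in>{1..n}. \<exists>!t. t * a + (1 - t) * b = c i) \<and>
    (\<exists>!(ps, qs). ps \<in> tuples n \<and> qs \<in> tuples n \<and> splitting_system a b n c w p q ps qs) \<and>
    splitting_system a b n c w p q
      (\<lambda>i\<in>{1..n}. w i * theta a b (c i))
      (\<lambda>i\<in>{1..n}. w i * (1 - theta a b (c i)))"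
proof -
  let ?ps = "\<lambda>i\<in>{1..n}. w i * theta a b (c i)"
  let ?qs = "\<lambda>i\<in>{1..n}. w i * (1 - theta a b (c i))"
  have split: "?ps i + ?qs i = w i \<and> (?ps i * a + ?qs i * b) / (?ps i + ?qs i) = c i"
    if "i \<in> {1..n}" for i
    using that by (intro iffD2[OF two_point_split_iff[OF assms(1) assms(3)[OF that]]]) simp
  have pos: "?ps i > 0" "?qs i > 0" if "i \<in> {1..n}" for i
    using theta_bounds[OF assms(1) assms(2)[OF that]] assms(3)[OF that] that by simp_all
  have sum_ps: "(\<Sum>i=1..n. ?ps i) = p"
    using sum_weighted_theta[OF assms(1,4,7,8)] by simp
  have sum_qs: "(\<Sum>i=1..n. ?qs i) = q"
  proof -
    have "(\<Sum>i=1..n. ?ps i) + (\<Sum>i=1..n. ?qs i) = (\<Sum>i=1..n. w i)"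
      unfolding sum.distrib[symmetric] using split by (intro sum.cong) blast+
    then show ?thesis
      using sum_ps assms(4,7) by linarith
  qed
  have solution: "splitting_system a b n c w p q ?ps ?qs"
    unfolding splitting_system_def using split pos sum_ps sum_qs by blast
  have unique: "ps = ?ps \<and> qs = ?qs"
    if "ps \<in> tuples n" "qs \<in> tuples n" "splitting_system a b n c w p q ps qs" for ps qs
  proof -
    have "ps i = w i * theta a b (c i) \<and> qs i = w i * (1 - theta a b (c i))"
      if i: "i \<in> {1..n}" for i
      using two_point_split_iff[OF assms(1) assms(3)[OF i]] i
        \<open>splitting_system a b n c w p q ps qs\<close>
      unfolding splitting_system_def by blast
    with that(1,2) show ?thesis
      by (auto intro!: extensionalityI[of _ "{1..n}"] simp: PiE_def)
  qed
  have "\<exists>!(ps, qs). ps \<in> tuples n \<and> qs \<in> tuples n \<and> splitting_system a b n c w p q ps qs"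
  proof (rule ex1I[of _ "(?ps, ?qs)"])
    show "case (?ps, ?qs) of (ps, qs) \<Rightarrow>
        ps \<in> tuples n \<and> qs \<in> tuples n \<and> splitting_system a b n c w p q ps qs"
      using solution by simp
  next
    fix z
    assume "case z of (ps, qs) \<Rightarrow>
        ps \<in> tuples n \<and> qs \<in> tuples n \<and> splitting_system a b n c w p q ps qs"
    then show "z = (?ps, ?qs)"
      by (cases z) (use unique in blast)
  qed
  then show ?thesis
    using solution by (intro conjI ballI barycentric_ex1[OF assms(1)])
qed

end
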